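(* Suppose the distributional and nondegeneracy assumptions stated in the context hold, and let $\pi$ be an online policy. Then $$\mathrm{Reg}_T^\pi=\sum_{j\in\mathcal J^*}(\mu_j-c_j^\top\lambda^* )\cdot E\left[n_j(T)-n_j^a(\tau)\right]+\sum_{j\in\mathcal J'}(c_j^\top\lambda^*-\mu_j)\cdot E\left[n_j^a(\tau)\right]+\lambda^{*\top}E\left[B_{\tau+1}\right].$$
   Context: **Setting (distributional assumption).** There are $T$ periods, $m$ resources and $n$ order types $(\mu_j,c_j)$, $j=1,\dots,n$, with $0\le\mu_j\le1$, $c_j\in\mathbb R^m$, $c_j\ge 0$, $\|c_j\|_\infty\le1$. Orders $(r_t,a_t)$, $t=1,\dots,T$, are i.i.d. with $P((r_t,a_t)=(\mu_j,c_j))=p_j$, where $p_j>0$. The capacity is $B=Tb$ with $b=(b_1,\dots,b_m)^\top>0$. An online policy $\pi$ chooses $x_t\in\{0,1\}$ after observing $(r_t,a_t)$, based on the past and possibly with randomization, keeping remaining capacities nonnegative. Put $B_1=B$, $B_t=B_{t-1}-a_{t-1}x_{t-1}$ for $t=2,\dots,T+1$ (with entries $B_{i,t}$), the remaining capacity at the beginning of period $t$. Let $n_j(t)$ be the number of type-$j$ orders arriving in periods $1,\dots,t$ and $n_j^a(t)$ the number of these accepted by $\pi$. **Benchmark and regret.** $\mathrm{OPT}_D=\max\{\sum_j p_j\mu_jy_j:\ \sum_j p_jc_jy_j\le b,\ 0\le y_j\le1\}$. $\tau=\min\{t: B_{i,t}\le 1\text{ for some }i\}-1$ (with $\tau=T$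 if there is no such $t\le T+1$). $\mathrm{Reg}_T^\pi=E[T\cdot\mathrm{OPT}_D-\sum_{t=1}^\tau r_tx_t]$. **Standard form and dual.** Let $\tilde\mu=(p_1\mu_1,\dots,p_n\mu_n)^\top$, $C=(p_1c_1,\dots,p_nc_n)$. LP (S): $\max\tilde\mu^\top y$ s.t. $Cy+s=b$, $y+z=\mathbf 1$, $y,s,z\ge0$, with optimal solution $(y^*,s^*,z^* )$. The dual is $\min b^\top\lambda+\sum_j\gamma_j$ s.t. $p_jc_j^\top\lambda+\gamma_j\ge p_j\mu_j$, $\lambda\ge0$, $\gamma_j\ge0$; $\lambda^*$ is the $\lambda$-part of its optimal solution. $\mathcal J^*=\{j:\mu_j\ge c_j^\top\lambda^*\}$, $\mathcal J'=\{j:\mu_j<c_j^\top\lambda^*\}$. **Nondegeneracy assumption.** The optimal solution of (S) is unique and $|\{j:y_j^*\ne0\}|+|\{i:s_i^*\neq0\}|+|\{j:z_j^*\ne0\}|=m+n$. *)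

theory Defs
  imports "HOL-Probability.Probability"
begin

text \<open>Resources are indexed by the finite type \<open>'m\<close> and order types by the finite type \<open>'n\<close>, so
  \<open>m = CARD('m)\<close> and \<open>n = CARD('n)\<close>. An order is a pair \<open>(r, a)\<close> of a reward and a consumption
  vector; periods are numbered from 1.\<close>

subsection \<open>Linear programs\<close>

definition weighted_rewards :: "('n::finite \<Rightarrow> real) \<Rightarrow> ('n \<Rightarrow> real) \<Rightarrow> real^'n" where
  "weighted_rewards p \<mu> = (\<chi> j. p j * \<mu> j)"

definition consumption_matrix :: "('n::finite \<Rightarrow> real) \<Rightarrow> ('n \<Rightarrow> real^'m) \<Rightarrow> real^'n^'m" where
  "consumption_matrix p c = (\<chi> i j. p j * c j $ i)"

text \<open>The feasible set is compact and contains 0 when \<open>b \<ge> 0\<close>, so the supremum is a maximum.\<close>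

definition OPT_D :: "('n::finite \<Rightarrow> real) \<Rightarrow> ('n \<Rightarrow> real) \<Rightarrow> ('n \<Rightarrow> real^'m) \<Rightarrow> real^'m \<Rightarrow> real" where
  "OPT_D p \<mu> c b =
     Sup {(\<Sum>j\<in>UNIV. p j * \<mu> j * y $ j) | y.
            (\<forall>i. (\<Sum>j\<in>UNIV. p j * c j $ i * y $ j) \<le> b $ i) \<and> (\<forall>j. 0 \<le> y $ j \<and> y $ j \<le> 1)}"

definition std_feasible ::
  "('n::finite \<Rightarrow> real) \<Rightarrow> ('n \<Rightarrow> real^'m) \<Rightarrow> real^'m \<Rightarrow> real^'n \<Rightarrow> real^'m \<Rightarrow> real^'n \<Rightarrow> bool" where
  "std_feasible p c b y s z \<longleftrightarrow>
     consumption_matrix p c *v y + s = b \<and> y + z = 1 \<and>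
     (\<forall>j. 0 \<le> y $ j) \<and> (\<forall>i. 0 \<le> s $ i) \<and> (\<forall>j. 0 \<le> z $ j)"

definition std_optimal ::
  "('n::finite \<Rightarrow> real) \<Rightarrow> ('n \<Rightarrow> real) \<Rightarrow> ('n \<Rightarrow> real^'m) \<Rightarrow> real^'m \<Rightarrow>
   real^'n \<Rightarrow> real^'m \<Rightarrow> real^'n \<Rightarrow> bool" where
  "std_optimal p \<mu> c b y s z \<longleftrightarrow>
     std_feasible p c b y s z \<and>
     (\<forall>y' s' z'. std_feasible p c b y' s' z' \<longrightarrow>
        weighted_rewards p \<mu> \<bullet> y' \<le> weighted_rewards p \<mu> \<bullet> y)"

definition nondegenerate ::
  "('n::finite \<Rightarrow> real) \<Rightarrow> ('n \<Rightarrow> real) \<Rightarrow> ('n \<Rightarrow> real^'m::finite) \<Rightarrow> real^'m \<Rightarrow> bool" where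
  "nondegenerate p \<mu> c b \<longleftrightarrow>
     (\<exists>y s z. std_optimal p \<mu> c b y s z \<and>
        (\<forall>y' s' z'. std_optimal p \<mu> c b y' s' z' \<longrightarrow> y' = y \<and> s' = s \<and> z' = z) \<and>
        card {j. y $ j \<noteq> 0} + card {i. s $ i \<noteq> 0} + card {j. z $ j \<noteq> 0} = CARD('m) + CARD('n))"

definition dual_feasible ::
  "('n::finite \<Rightarrow> real) \<Rightarrow> ('n \<Rightarrow> real) \<Rightarrow> ('n \<Rightarrow> real^'m) \<Rightarrow> real^'m \<Rightarrow> real^'n \<Rightarrow> bool" where
  "dual_feasible p \<mu> c l \<gamma> \<longleftrightarrow>
     (\<forall>j. p j * (c j \<bullet> l) + \<gamma> $ j \<ge> p j * \<mu> j) \<and> (\<forall>i. 0 \<le> l $ i) \<and> (\<forall>j. 0 \<le> \<gamma> $ j)"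

definition dual_optimal ::
  "('n::finite \<Rightarrow> real) \<Rightarrow> ('n \<Rightarrow> real) \<Rightarrow> ('n \<Rightarrow> real^'m) \<Rightarrow> real^'m \<Rightarrow> real^'m \<Rightarrow> real^'n \<Rightarrow> bool" where
  "dual_optimal p \<mu> c b l \<gamma> \<longleftrightarrow>
     dual_feasible p \<mu> c l \<gamma> \<and>
     (\<forall>l' \<gamma>'. dual_feasible p \<mu> c l' \<gamma>' \<longrightarrow>
        b \<bullet> l + (\<Sum>j\<in>UNIV. \<gamma> $ j) \<le> b \<bullet> l' + (\<Sum>j\<in>UNIV. \<gamma>' $ j))"

subsection \<open>Quantities along one sample path\<close>

text \<open>Here \<open>q\<close> is a sequence of orders and \<open>x\<close> a sequence of decisions. The capacity \<open>remaining B q x t\<close>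
  at the beginning of period \<open>t\<close> is meant for \<open>t \<ge> 1\<close>; the value at 0 is a dummy.\<close>

fun remaining ::
  "real^'m \<Rightarrow> (nat \<Rightarrow> real \<times> (real^'m)) \<Rightarrow> (nat \<Rightarrow> real) \<Rightarrow> nat \<Rightarrow> real^'m" where
  "remaining B q x 0 = B"
| "remaining B q x (Suc 0) = B"
| "remaining B q x (Suc (Suc t)) = remaining B q x (Suc t) - x (Suc t) *\<^sub>R snd (q (Suc t))"

definition stop_time ::
  "nat \<Rightarrow> real^'m \<Rightarrow> (nat \<Rightarrow> real \<times> (real^'m)) \<Rightarrow> (nat \<Rightarrow> real) \<Rightarrow> nat" where
  "stop_time T B q x =
     (if \<exists>t\<in>{1..T+1}. \<exists>i. remaining B q x t $ i \<le> 1
      then (LEAST t. t \<in> {1..T+1} \<and> (\<exists>i. remaining B q x t $ i \<le> 1)) - 1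
      else T)"

text \<open>In the two counts, \<open>k\<close> is the order \<open>(\<mu>\<^sub>j, c\<^sub>j)\<close> being counted.\<close>

definition arrivals :: "real \<times> (real^'m) \<Rightarrow> (nat \<Rightarrow> real \<times> (real^'m)) \<Rightarrow> nat \<Rightarrow> nat" where
  "arrivals k q t = card {s \<in> {1..t}. q s = k}"

definition accepted ::
  "real \<times> (real^'m) \<Rightarrow> (nat \<Rightarrow> real \<times> (real^'m)) \<Rightarrow> (nat \<Rightarrow> real) \<Rightarrow> nat \<Rightarrow> nat" where
  "accepted k q x t = card {s \<in> {1..t}. q s = k \<and> x s = 1}"

subsection \<open>Random orders, policies and regret\<close>

definition iid_orders ::
  "'w measure \<Rightarrow> nat \<Rightarrow> ('n::finite \<Rightarrow> real) \<Rightarrow> ('n \<Rightarrow> real) \<Rightarrow> ('n \<Rightarrow> real^'m) \<Rightarrow>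
   (nat \<Rightarrow> 'w \<Rightarrow> real \<times> (real^'m)) \<Rightarrow> bool" where
  "iid_orders M T p \<mu> c ord \<longleftrightarrow>
     prob_space.indep_vars M (\<lambda>_. borel) ord {1..T} \<and>
     (\<forall>t\<in>{1..T}. \<forall>j. measure M {\<omega> \<in> space M. ord t \<omega> = (\<mu> j, c j)} = p j)"

text \<open>A policy is a family of decision rules \<open>\<pi> t\<close> applied to a random seed \<open>U\<close>, with values in an
  arbitrary measurable space \<open>S\<close>, and to the orders of periods \<open>1, \<dots>, t\<close>. Earlier decisions are
  functions of the same data, so they need not be separate arguments. The independence of seed and
  orders below is stated for the generated \<open>\<sigma>\<close>-algebras because \<^const>\<open>prob_space.indep_var\<close>
  needs both variables to have the same range type.\<close>

definition decision ::
  "(nat \<Rightarrow> 'u \<times> (nat \<Rightarrow> 'a) \<Rightarrow> real) \<Rightarrow> ('w \<Rightarrow> 'u) \<Rightarrow> (nat \<Rightarrow> 'w \<Rightarrow> 'a) \<Rightarrow> 'w \<Rightarrow> nat \<Rightarrow> real" where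
  "decision \<pi> U ord \<omega> t = \<pi> t (U \<omega>, \<lambda>s\<in>{1..t}. ord s \<omega>)"

text \<open>Membership in \<open>measurable _ (count_space {0, 1})\<close> includes that the decisions are 0 or 1.\<close>

definition online_policy ::
  "'w measure \<Rightarrow> nat \<Rightarrow> real^'m \<Rightarrow> (nat \<Rightarrow> 'w \<Rightarrow> real \<times> (real^'m)) \<Rightarrow> 'u measure \<Rightarrow> ('w \<Rightarrow> 'u) \<Rightarrow>
   (nat \<Rightarrow> 'u \<times> (nat \<Rightarrow> real \<times> (real^'m)) \<Rightarrow> real) \<Rightarrow> bool" where
  "online_policy M T B ord S U \<pi> \<longleftrightarrow>
     U \<in> measurable M S \<and>
     prob_space.indep_set M (sets (vimage_algebra (space M) U S))
       (sets (vimage_algebra (space M) (\<lambda>\<omega>. \<lambda>t\<in>{1..T}. ord t \<omega>) (Pi\<^sub>M {1..T} (\<lambda>_. borel)))) \<and>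
     (\<forall>t\<in>{1..T}. \<pi> t \<in> measurable (S \<Otimes>\<^sub>M Pi\<^sub>M {1..t} (\<lambda>_. borel)) (count_space {0, 1})) \<and>
     (AE \<omega> in M. \<forall>t\<in>{1..T+1}. \<forall>i.
        0 \<le> remaining B (\<lambda>s. ord s \<omega>) (decision \<pi> U ord \<omega>) t $ i)"

definition regret ::
  "'w measure \<Rightarrow> nat \<Rightarrow> ('n::finite \<Rightarrow> real) \<Rightarrow> ('n \<Rightarrow> real) \<Rightarrow> ('n \<Rightarrow> real^'m) \<Rightarrow> real^'m \<Rightarrow>
   (nat \<Rightarrow> 'w \<Rightarrow> real \<times> (real^'m)) \<Rightarrow> ('w \<Rightarrow> 'u) \<Rightarrow>
   (nat \<Rightarrow> 'u \<times> (nat \<Rightarrow> real \<times> (real^'m)) \<Rightarrow> real) \<Rightarrow> real" where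
  "regret M T p \<mu> c b ord U \<pi> =
     (\<integral>\<omega>. real T * OPT_D p \<mu> c b -
        (\<Sum>t = 1..stop_time T (real T *\<^sub>R b) (\<lambda>s. ord s \<omega>) (decision \<pi> U ord \<omega>).
           fst (ord t \<omega>) * decision \<pi> U ord \<omega> t) \<partial>M)"

end

theory Submission
  imports Defs
begin

text \<open>By strong duality \<open>OPT\<^sub>D = b\<^sup>T\<lambda> + \<Sum>\<^sub>j p\<^sub>j (\<mu>\<^sub>j - c\<^sub>j\<^sup>T\<lambda>)\<^sup>+\<close>. Scaled by \<open>T\<close>, the first term is the value \<open>B\<^sup>T\<lambda>\<close> of the
  initial capacity, which along each path is the value of \<open>B\<close> at \<open>\<tau> + 1\<close> plus the value
  \<open>c\<^sub>j\<^sup>T\<lambda>\<close> of each accepted order; the second is the expectation of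
  \<open>(\<mu>\<^sub>j - c\<^sub>j\<^sup>T\<lambda>)\<^sup>+ n\<^sub>j(T)\<close> summed over \<open>j\<close>. Subtracting the collected rewards
  \<open>\<mu>\<^sub>j\<close> and sorting by the sign of \<open>\<mu>\<^sub>j - c\<^sub>j\<^sup>T\<lambda>\<close> gives the identity.\<close>

section \<open>Linear programming duality\<close>

text \<open>Separate the attainable pairs (excess consumption, reward) from the pairs with nonpositive excess
  and reward above the optimum. Since \<open>b > 0\<close>, the choice \<open>y = 0\<close> is a Slater point, so the
  separating hyperplane is not vertical and its normalised slope is a vector of multipliers.\<close>

lemma OPT_D_multipliers:
  fixes p \<mu> :: "'n::finite \<Rightarrow> real" and c :: "'n \<Rightarrow> real^'m::finite" and b :: "real^'m"
  assumes b_pos: "\<And>i. 0 < b $ i"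
    and upper: "\<And>y. \<lbrakk>\<And>i. (\<Sum>j\<in>UNIV. p j * c j $ i * y $ j) \<le> b $ i; \<And>j. 0 \<le> y $ j \<and> y $ j \<le> 1\<rbrakk>
                  \<Longrightarrow> (\<Sum>j\<in>UNIV. p j * \<mu> j * y $ j) \<le> v"
  obtains l where "\<And>i. 0 \<le> l $ i"
    "b \<bullet> l + (\<Sum>j\<in>UNIV. max 0 (p j * (\<mu> j - c j \<bullet> l))) \<le> v"
proof -
  define F :: "real^'n \<Rightarrow> (real^'m) \<times> real" where
    "F y = (\<Sum>j\<in>UNIV. (p j * y $ j) *\<^sub>R c j, \<Sum>j\<in>UNIV. p j * \<mu> j * y $ j)" for y
  define K where "K = (\<lambda>w. (- b, 0) + w) ` F ` cbox 0 1"
  define N :: "((real^'m) \<times> real) set" where "N = {u. \<forall>i. u $ i \<le> 0} \<times> {v<..}"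
  have "linear F"
    by (rule linearI)
      (simp_all add: F_def distrib_left scaleR_add_left sum.distrib scaleR_right.sum sum_distrib_left
        mult.left_commute)
  then have "convex K"
    unfolding K_def by (intro convex_translation convex_linear_image convex_box)
  have "convex {u :: real^'m. \<forall>i. u $ i \<le> 0}"
    by (rule convexI) (auto intro!: add_nonpos_nonpos mult_nonneg_nonpos)
  then have "convex N"
    unfolding N_def by (intro convex_Times) auto
  have F_fst: "fst (F y) $ i = (\<Sum>j\<in>UNIV. p j * c j $ i * y $ j)" for y i
    by (simp add: F_def mult_ac)
  \<comment> \<open>A common point would come from a feasible \<open>y\<close> with reward above
    \<open>v\<close>, which \<open>upper\<close> forbids.\<close>
  have "K \<inter> N = {}"
  proof (rule equals0I)
    fix w assume "w \<in> K \<inter> N"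
    then obtain y where y: "y \<in> cbox 0 1" and N: "(- b, 0) + F y \<in> N"
      unfolding K_def by auto
    from N have "fst (F y) $ i \<le> b $ i" for i
      by (cases "F y") (auto simp: N_def dest: spec[of _ i])
    moreover from N have "v < snd (F y)"
      by (cases "F y") (auto simp: N_def)
    ultimately show False
      using upper[of y] y unfolding F_fst by (auto simp: mem_box_cart F_def)
  qed
  moreover have "K \<noteq> {}" unfolding K_def by (simp add: interval_eq_empty_cart)
  moreover have "(0, v + 1) \<in> N" unfolding N_def by simp
  then have "N \<noteq> {}" by blast
  ultimately obtain a \<beta> where a: "a \<noteq> 0"
    and aK: "\<And>w. w \<in> K \<Longrightarrow> a \<bullet> w \<le> \<beta>" and aN: "\<And>w. w \<in> N \<Longrightarrow> \<beta> \<le> a \<bullet> w"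
    using separating_hyperplane_sets[OF \<open>convex K\<close> \<open>convex N\<close>] by metis
  obtain \<alpha> k where ak: "a = (\<alpha>, k)" by fastforce
  have sepN: "\<beta> \<le> \<alpha> \<bullet> u + k * r" if "\<And>i. u $ i \<le> 0" "v < r" for u r
    using aN[of "(u, r)"] that by (simp add: N_def ak)
  have sepK: "\<alpha> \<bullet> fst (F y) - \<alpha> \<bullet> b + k * snd (F y) \<le> \<beta>" if "\<And>j. 0 \<le> y $ j \<and> y $ j \<le> 1" for y
  proof -
    have "(- b, 0) + F y \<in> K" unfolding K_def using that by (auto simp: mem_box_cart)
    from aK[OF this] show ?thesis
      by (cases "F y") (simp add: ak inner_diff_right)
  qed
  have k0: "0 \<le> k"
  proof (rule ccontr)
    assume "\<not> 0 \<le> k"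
    \<comment> \<open>\<open>N\<close> contains arbitrarily large rewards, so a negative
      \<open>k\<close> would violate the lower bound \<beta>: the term \<open>v + 1\<close> keeps
      \<open>r\<close> above \<open>v\<close>, and \<open>(\<beta> - 1) / k\<close> forces
      \<open>k * r \<le> \<beta> - 1\<close>.\<close>
    define r where "r = max (v + 1) ((\<beta> - 1) / k)"
    have "\<beta> \<le> k * r" using sepN[of 0 r] by (simp add: r_def)
    also have "k * r \<le> k * ((\<beta> - 1) / k)"
      using \<open>\<not> 0 \<le> k\<close> by (intro mult_left_mono_neg) (auto simp: r_def)
    also have "\<dots> = \<beta> - 1" using \<open>\<not> 0 \<le> k\<close> by simp
    finally show False by simp
  qed
  have \<alpha>0: "\<alpha> $ i \<le> 0" for i
  proof (rule ccontr)
    assume pos: "\<not> \<alpha> $ i \<le> 0"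
    \<comment> \<open>\<open>N\<close> is unbounded along the negative \<open>i\<close>-th axis. The
      step length \<open>s\<close> lowers the functional by
      \<open>\<bar>k * (v + 1) - \<beta>\<bar> + 1\<close>, enough to bring it below \<beta> at
      reward \<open>v + 1\<close>.\<close>
    define s where "s = (\<bar>k * (v + 1) - \<beta>\<bar> + 1) / \<alpha> $ i"
    have "s \<ge> 0" using pos by (simp add: s_def)
    then have "\<beta> \<le> \<alpha> \<bullet> (- s *\<^sub>R axis i 1) + k * (v + 1)"
      by (intro sepN) (auto simp: axis_def)
    also have "\<alpha> \<bullet> (- s *\<^sub>R axis i 1) = - (\<bar>k * (v + 1) - \<beta>\<bar> + 1)"
      using pos by (simp add: inner_axis s_def)
    finally show False by linarith
  qed
  \<comment> \<open>Rewards in \<open>N\<close> lie strictly above \<open>v\<close>, so the bound at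
    \<open>v\<close> is a limit. The divisor \<open>k + 1\<close> stays positive even for
    \<open>k = 0\<close>, which is not yet excluded.\<close>
  have \<beta>_le: "\<beta> \<le> k * v"
  proof (rule field_le_epsilon)
    fix e :: real assume "0 < e"
    have "\<beta> \<le> k * (v + e / (k + 1))"
      using sepN[of 0 "v + e / (k + 1)"] \<open>0 < e\<close> k0 by simp
    also have "k * (e / (k + 1)) \<le> e"
      using \<open>0 < e\<close> k0 by (simp add: field_simps)
    then have "k * (v + e / (k + 1)) \<le> k * v + e" by (simp add: distrib_left)
    finally show "\<beta> \<le> k * v + e" .
  qed
  \<comment> \<open>Slater's condition: for \<open>k = 0\<close> the point \<open>y = 0\<close>
    gives \<open>- (\<alpha> \<bullet> b) \<le> 0\<close>. This is a sum of nonnegative terms with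
    \<open>b > 0\<close>, so \<alpha> vanishes too, against \<open>a \<noteq> 0\<close>.\<close>
  have "k \<noteq> 0"
  proof
    assume k: "k = 0"
    have "- (\<alpha> \<bullet> b) \<le> 0"
      using sepK[of 0] \<beta>_le k by (simp add: F_def)
    moreover have nonneg: "- (\<alpha> $ i * b $ i) \<ge> 0" for i
      using \<alpha>0[of i] b_pos[of i] by (simp add: mult_nonpos_nonneg)
    ultimately have "(\<Sum>i\<in>UNIV. - (\<alpha> $ i * b $ i)) = 0"
      by (intro antisym sum_nonneg) (auto simp: inner_vec_def sum_negf)
    then have "\<alpha> $ i * b $ i = 0" for i
      using sum_nonneg_eq_0_iff[of UNIV "\<lambda>i. - (\<alpha> $ i * b $ i)"] nonneg by simp
    then have "\<alpha> = 0" using b_pos by (simp add: vec_eq_iff order_less_imp_not_eq2)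
    then show False using a ak k by (simp add: zero_prod_def)
  qed
  with k0 have kpos: "0 < k" by simp
  define l where "l = (- 1 / k) *\<^sub>R \<alpha>"
  have \<alpha>_eq: "\<alpha> = - k *\<^sub>R l" using kpos by (simp add: l_def)
  \<comment> \<open>This \<open>y\<close> maximises the Lagrangian for \<open>l\<close> over the
    unit box, one coordinate at a time; the maximum is the sum of positive parts.\<close>
  define y :: "real^'n" where "y = (\<chi> j. if 0 \<le> p j * (\<mu> j - c j \<bullet> l) then 1 else 0)"
  have "k * (b \<bullet> l + snd (F y) - l \<bullet> fst (F y)) \<le> k * v"
  proof -
    have "\<And>j. 0 \<le> y $ j \<and> y $ j \<le> 1" by (simp add: y_def)
    from sepK[OF this] \<beta>_le show ?thesis by (simp add: \<alpha>_eq algebra_simps inner_commute)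
  qed
  then have "b \<bullet> l + (snd (F y) - l \<bullet> fst (F y)) \<le> v"
    using kpos by simp
  also have "snd (F y) - l \<bullet> fst (F y) = (\<Sum>j\<in>UNIV. p j * (\<mu> j - c j \<bullet> l) * y $ j)"
    by (simp add: F_def inner_sum_right sum_subtractf[symmetric] algebra_simps inner_commute)
  also have "\<dots> = (\<Sum>j\<in>UNIV. max 0 (p j * (\<mu> j - c j \<bullet> l)))"
    by (intro sum.cong) (auto simp: y_def max_def)
  finally have "b \<bullet> l + (\<Sum>j\<in>UNIV. max 0 (p j * (\<mu> j - c j \<bullet> l))) \<le> v" .
  moreover have "0 \<le> l $ i" for i
    using \<alpha>0[of i] kpos by (simp add: l_def divide_nonpos_pos)
  ultimately show thesis using that by blast
qed

text \<open>For fixed multipliers the cheapest admissible \<gamma> consists of the positive parts,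
  so the dual amounts to minimising \<open>val\<close> over nonnegative vectors. Weak duality puts
  the supremum below every \<open>val l'\<close>; the multipliers from
  \<open>OPT_D_multipliers\<close> and the minimality of \<open>val l\<close> give the
  converse.\<close>

lemma OPT_D_eq_dual_value:
  fixes p \<mu> :: "'n::finite \<Rightarrow> real" and c :: "'n \<Rightarrow> real^'m::finite" and b l :: "real^'m"
  assumes b_pos: "\<And>i. 0 < b $ i" and dual: "dual_optimal p \<mu> c b l \<gamma>"
  shows "OPT_D p \<mu> c b = b \<bullet> l + (\<Sum>j\<in>UNIV. max 0 (p j * (\<mu> j - c j \<bullet> l)))"
proof -
  define val where "val l' = b \<bullet> l' + (\<Sum>j\<in>UNIV. max 0 (p j * (\<mu> j - c j \<bullet> l')))" for l'
  define P where "P = {(\<Sum>j\<in>UNIV. p j * \<mu> j * y $ j) | y.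
     (\<forall>i. (\<Sum>j\<in>UNIV. p j * c j $ i * y $ j) \<le> b $ i) \<and> (\<forall>j. 0 \<le> y $ j \<and> y $ j \<le> 1)}"
  \<comment> \<open>Each \<mu> is split into \<open>c j \<bullet> l'\<close> and a surplus. After
    exchanging sums, the capacity constraints bound the first part by \<open>b \<bullet> l'\<close>;
    \<open>0 \<le> y \<le> 1\<close> bounds the second by positive parts.\<close>
  have weak: "r \<le> val l'" if l': "\<And>i. 0 \<le> l' $ i" and "r \<in> P" for l' r
  proof -
    from \<open>r \<in> P\<close> obtain y where r: "r = (\<Sum>j\<in>UNIV. p j * \<mu> j * y $ j)"
      and y: "\<And>i. (\<Sum>j\<in>UNIV. p j * c j $ i * y $ j) \<le> b $ i" "\<And>j. 0 \<le> y $ j" "\<And>j. y $ j \<le> 1"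
      by (auto simp: P_def)
    have "(\<Sum>j\<in>UNIV. p j * (c j \<bullet> l') * y $ j)
        = (\<Sum>i\<in>UNIV. (\<Sum>j\<in>UNIV. p j * c j $ i * y $ j) * l' $ i)"
      unfolding inner_vec_def sum_distrib_left sum_distrib_right
      by (subst sum.swap) (simp add: mult_ac)
    also have "\<dots> \<le> b \<bullet> l'"
      unfolding inner_vec_def by (auto intro!: sum_mono mult_right_mono y l')
    finally have "(\<Sum>j\<in>UNIV. p j * (c j \<bullet> l') * y $ j) \<le> b \<bullet> l'" .
    moreover have "p j * (\<mu> j - c j \<bullet> l') * y $ j \<le> max 0 (p j * (\<mu> j - c j \<bullet> l'))" for j
    proof -
      have "p j * (\<mu> j - c j \<bullet> l') * y $ j \<le> max 0 (p j * (\<mu> j - c j \<bullet> l')) * y $ j"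
        by (rule mult_right_mono) (auto simp: y)
      also have "\<dots> \<le> max 0 (p j * (\<mu> j - c j \<bullet> l'))"
        by (rule mult_left_le) (auto simp: y)
      finally show ?thesis .
    qed
    then have "(\<Sum>j\<in>UNIV. p j * (\<mu> j - c j \<bullet> l') * y $ j) \<le> (\<Sum>j\<in>UNIV. max 0 (p j * (\<mu> j - c j \<bullet> l')))"
      by (intro sum_mono)
    ultimately show ?thesis
      unfolding r val_def by (simp add: algebra_simps sum_subtractf)
  qed
  have feas: "dual_feasible p \<mu> c l' (\<chi> j. max 0 (p j * (\<mu> j - c j \<bullet> l')))" if "\<And>i. 0 \<le> l' $ i" for l'
    using that by (auto simp: dual_feasible_def algebra_simps max_def)
  have l0: "\<And>i. 0 \<le> l $ i" and \<gamma>: "\<And>j. max 0 (p j * (\<mu> j - c j \<bullet> l)) \<le> \<gamma> $ j"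
    using dual by (auto simp: dual_optimal_def dual_feasible_def algebra_simps)
  \<comment> \<open>The given \<gamma> is only known to dominate the positive parts, which already
    puts \<open>val l\<close> below the optimal dual value.\<close>
  have val_min: "val l \<le> val l'" if "\<And>i. 0 \<le> l' $ i" for l'
  proof -
    have "val l \<le> b \<bullet> l + (\<Sum>j\<in>UNIV. \<gamma> $ j)"
      unfolding val_def by (intro add_left_mono sum_mono \<gamma>)
    also have "\<dots> \<le> val l'"
      using dual feas[OF that] unfolding dual_optimal_def val_def by fastforce
    finally show ?thesis .
  qed
  have "0 \<in> P"
    unfolding P_def using b_pos by (auto intro!: exI[of _ 0] simp: less_imp_le)
  \<comment> \<open>A real \<open>Sup\<close> is an upper bound only for bounded sets; this is what
    allows \<open>OPT_D_multipliers\<close> to be applied with \<open>v = Sup P\<close>.\<close>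
  have "bdd_above P" using weak[OF l0] by (auto simp: bdd_above_def)
  obtain l' where "\<And>i. 0 \<le> l' $ i" "val l' \<le> Sup P"
    using OPT_D_multipliers[of b p c \<mu> "Sup P"] b_pos cSup_upper[OF _ \<open>bdd_above P\<close>]
    unfolding val_def P_def by blast
  with val_min have "val l \<le> Sup P" by fastforce
  moreover have "Sup P \<le> val l"
    using \<open>0 \<in> P\<close> weak[OF l0] by (intro cSup_least) auto
  ultimately show ?thesis unfolding OPT_D_def P_def[symmetric] val_def by simp
qed

section \<open>Sample paths\<close>

text \<open>Capacity at the start of period \<open>t + 1\<close> has paid for periods 1 to
  \<open>t\<close>, so the capacity at \<tau> + 1 matches sums ending at \<tau>. The index
  \<open>Suc t\<close> bypasses the dummy value at 0.\<close>

lemma remaining_Suc: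
  "remaining B q x (Suc t) = B - (\<Sum>s = 1..t. x s *\<^sub>R snd (q s))"
  by (induction t) (simp_all add: algebra_simps)

lemma stop_time_le: "stop_time T B q x \<le> T"
proof (cases "\<exists>t\<in>{1..T+1}. \<exists>i. remaining B q x t $ i \<le> 1")
  case True
  then obtain t where t: "t \<in> {1..T+1}" "\<exists>i. remaining B q x t $ i \<le> 1" by blast
  then have "(LEAST t. t \<in> {1..T+1} \<and> (\<exists>i. remaining B q x t $ i \<le> 1)) \<le> t"
    by (intro Least_le) auto
  with t True show ?thesis by (auto simp: stop_time_def)
qed (auto simp: stop_time_def)

text \<open>Indicator sums open the counts to linearity and to measurability arguments.\<close>

lemma accepted_eq_sum:
  "real (accepted k q x t) = (\<Sum>s = 1..t. of_bool (q s = k \<and> x s = 1))"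
proof -
  have "{s \<in> {1..t}. q s = k \<and> x s = 1} = {1..t} \<inter> {s. q s = k \<and> x s = 1}" by auto
  then show ?thesis by (simp add: accepted_def sum_of_bool_eq)
qed

lemma arrivals_eq_sum:
  "real (arrivals k q t) = (\<Sum>s = 1..t. of_bool (q s = k))"
proof -
  have "{s \<in> {1..t}. q s = k} = {1..t} \<inter> {s. q s = k}" by auto
  then show ?thesis by (simp add: arrivals_def sum_of_bool_eq)
qed

lemma accepted_le: "accepted k q x t \<le> t"
proof -
  have "accepted k q x t \<le> card {1..t}"
    unfolding accepted_def by (intro card_mono) auto
  then show ?thesis by simp
qed

text \<open>By injectivity each order matches exactly one type, so the inner sum over types has a
  single candidate term; exchanging sums then produces the counts. The vector-valued
  \<open>f\<close> lets one lemma serve both rewards (\<open>fst\<close>) and consumption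
  (\<open>snd\<close>).\<close>

lemma sum_by_type:
  fixes k :: "'n::finite \<Rightarrow> real \<times> (real^'m)" and f :: "real \<times> (real^'m) \<Rightarrow> 'v::real_vector"
  assumes inj: "inj k"
    and q: "\<And>s. s \<in> {1..t} \<Longrightarrow> q s \<in> range k" and x: "\<And>s. s \<in> {1..t} \<Longrightarrow> x s \<in> {0, 1}"
  shows "(\<Sum>s = 1..t. x s *\<^sub>R f (q s)) = (\<Sum>j\<in>UNIV. real (accepted (k j) q x t) *\<^sub>R f (k j))"
proof -
  have "x s *\<^sub>R f (q s) = (\<Sum>j\<in>UNIV. of_bool (q s = k j \<and> x s = 1) *\<^sub>R f (k j))"
    if s: "s \<in> {1..t}" for s
  proof -
    from q[OF s] obtain j0 where j0: "q s = k j0" by blast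
    have "(\<Sum>j\<in>UNIV. of_bool (q s = k j \<and> x s = 1) *\<^sub>R f (k j))
        = (\<Sum>j\<in>UNIV. if j0 = j then x s *\<^sub>R f (k j) else 0)"
      using x[OF s] inj by (intro sum.cong) (auto simp: j0 inj_eq)
    then show ?thesis by (simp add: j0)
  qed
  then have "(\<Sum>s = 1..t. x s *\<^sub>R f (q s))
      = (\<Sum>s = 1..t. \<Sum>j\<in>UNIV. of_bool (q s = k j \<and> x s = 1) *\<^sub>R f (k j))"
    by (intro sum.cong) auto
  also have "\<dots> = (\<Sum>j\<in>UNIV. real (accepted (k j) q x t) *\<^sub>R f (k j))"
    by (subst sum.swap) (simp only: accepted_eq_sum scaleR_left.sum)
  finally show ?thesis .
qed

section \<open>Measurability and expectations\<close>

text \<open>The random upper limit becomes a condition \<open>t \<le> \<tau> \<omega>\<close> inside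
  a sum of fixed length \<open>T\<close>.\<close>

lemma borel_measurable_sum_random_upto:
  fixes f :: "nat \<Rightarrow> 'w \<Rightarrow> 'v::{second_countable_topology, real_normed_vector}"
  assumes \<tau>: "\<tau> \<in> measurable M (count_space UNIV)" and le: "\<And>\<omega>. \<tau> \<omega> \<le> T"
    and f: "\<And>t. t \<in> {1..T} \<Longrightarrow> f t \<in> borel_measurable M"
  shows "(\<lambda>\<omega>. \<Sum>t = 1..\<tau> \<omega>. f t \<omega>) \<in> borel_measurable M"
proof -
  note [measurable] = \<tau>
  have "(\<Sum>t = 1..\<tau> \<omega>. f t \<omega>) = (\<Sum>t = 1..T. if t \<le> \<tau> \<omega> then f t \<omega> else 0)" for \<omega>
    using le[of \<omega>] by (intro sum.mono_neutral_cong_left) auto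
  moreover have "(\<lambda>\<omega>. \<Sum>t = 1..T. if t \<le> \<tau> \<omega> then f t \<omega> else 0) \<in> borel_measurable M"
  proof (rule borel_measurable_sum)
    fix t assume "t \<in> {1..T}"
    note [measurable] = f[OF this]
    show "(\<lambda>\<omega>. if t \<le> \<tau> \<omega> then f t \<omega> else 0) \<in> borel_measurable M" by measurable
  qed
  ultimately show ?thesis by simp
qed

text \<open>Orders are measurable for the Borel sets of the product topology, so the projections are
  handled through their continuity.\<close>

lemma borel_measurable_fst_snd [measurable (raw)]:
  fixes f :: "'w \<Rightarrow> 'b::topological_space \<times> 'c::topological_space"
  assumes "f \<in> borel_measurable M"
  shows "(\<lambda>\<omega>. fst (f \<omega>)) \<in> borel_measurable M" "(\<lambda>\<omega>. snd (f \<omega>)) \<in> borel_measurable M"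
  using assms
  by (rule measurable_compose, intro borel_measurable_continuous_onI continuous_intros)+

lemma measurable_remaining:
  fixes ord :: "nat \<Rightarrow> 'w \<Rightarrow> real \<times> (real^'m::finite)"
  assumes ord: "\<And>s. s \<in> {1..T} \<Longrightarrow> ord s \<in> borel_measurable M"
    and x: "\<And>s. s \<in> {1..T} \<Longrightarrow> (\<lambda>\<omega>. x \<omega> s) \<in> borel_measurable M"
    and "t \<le> T + 1"
  shows "(\<lambda>\<omega>. remaining B (\<lambda>s. ord s \<omega>) (x \<omega>) t) \<in> borel_measurable M"
proof (cases t)
  case (Suc t')
  have "(\<lambda>\<omega>. x \<omega> s *\<^sub>R snd (ord s \<omega>)) \<in> borel_measurable M" if "s \<in> {1..t'}" for s
  proof -
    have s: "s \<in> {1..T}" using that Suc \<open>t \<le> T + 1\<close> by auto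
    note [measurable] = ord[OF s] x[OF s]
    show ?thesis by measurable
  qed
  then show ?thesis by (simp add: Suc remaining_Suc)
qed simp

lemma measurable_stop_time:
  fixes ord :: "nat \<Rightarrow> 'w \<Rightarrow> real \<times> (real^'m::finite)"
  assumes ord: "\<And>s. s \<in> {1..T} \<Longrightarrow> ord s \<in> borel_measurable M"
    and x: "\<And>s. s \<in> {1..T} \<Longrightarrow> (\<lambda>\<omega>. x \<omega> s) \<in> borel_measurable M"
  shows "(\<lambda>\<omega>. stop_time T B (\<lambda>s. ord s \<omega>) (x \<omega>)) \<in> measurable M (count_space UNIV)"
proof -
  have low: "Measurable.pred M (\<lambda>\<omega>. \<exists>i. remaining B (\<lambda>s. ord s \<omega>) (x \<omega>) t $ i \<le> 1)"
    if "t \<in> {1..T+1}" for t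
  proof -
    have [measurable]: "(\<lambda>\<omega>. remaining B (\<lambda>s. ord s \<omega>) (x \<omega>) t) \<in> borel_measurable M"
      using that by (intro measurable_remaining[where T = T] ord x) auto
    have [measurable]: "(\<lambda>\<omega>. remaining B (\<lambda>s. ord s \<omega>) (x \<omega>) t $ i) \<in> borel_measurable M" for i
      unfolding cart_eq_inner_axis by measurable
    show ?thesis by measurable
  qed
  \<comment> \<open>The range condition stays inside the predicate under \<open>LEAST\<close>:
    beyond \<open>T + 1\<close> the predicate is constantly false, while orders and decisions are
    known to be measurable only up to \<open>T\<close>.\<close>
  have [measurable]: "Measurable.pred M
      (\<lambda>\<omega>. t \<in> {1..T+1} \<and> (\<exists>i. remaining B (\<lambda>s. ord s \<omega>) (x \<omega>) t $ i \<le> 1))" for t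
    using low by (cases "t \<in> {1..T+1}") auto
  show ?thesis unfolding stop_time_def Bex_def by measurable
qed

lemma online_policy_decision_measurable:
  fixes ord :: "nat \<Rightarrow> 'w \<Rightarrow> real \<times> (real^'m::finite)"
  assumes policy: "online_policy M T B ord S U \<pi>"
    and ord: "\<And>s. s \<in> {1..T} \<Longrightarrow> ord s \<in> borel_measurable M"
    and t: "t \<in> {1..T}"
  shows "(\<lambda>\<omega>. decision \<pi> U ord \<omega> t) \<in> measurable M (count_space {0, 1})"
proof -
  have [measurable]: "U \<in> measurable M S"
    and \<pi>: "\<pi> t \<in> measurable (S \<Otimes>\<^sub>M Pi\<^sub>M {1..t} (\<lambda>_. borel)) (count_space {0, 1})"
    using policy t by (auto simp: online_policy_def)
  have [measurable]: "(\<lambda>\<omega>. \<lambda>s\<in>{1..t}. ord s \<omega>) \<in> measurable M (Pi\<^sub>M {1..t} (\<lambda>_. borel))"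
    using t by (intro measurable_restrict ord) auto
  have "(\<lambda>\<omega>. (U \<omega>, \<lambda>s\<in>{1..t}. ord s \<omega>)) \<in> measurable M (S \<Otimes>\<^sub>M Pi\<^sub>M {1..t} (\<lambda>_. borel))"
    by measurable
  from measurable_compose[OF this \<pi>] show ?thesis by (simp add: decision_def)
qed

text \<open>Injectivity makes the events disjoint, so their probabilities add up to 1 and nothing is
  left for other values. This turns the point masses of the order types into an almost sure
  statement.\<close>

lemma (in prob_space) AE_in_range:
  fixes k :: "'n::finite \<Rightarrow> 'b::{second_countable_topology, t2_space}"
  assumes [measurable]: "X \<in> borel_measurable M" and "inj k"
    and "(\<Sum>j\<in>UNIV. prob {\<omega> \<in> space M. X \<omega> = k j}) = 1"
  shows "AE \<omega> in M. X \<omega> \<in> range k"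
proof -
  have range_eq: "{\<omega> \<in> space M. X \<omega> \<in> range k} = (\<Union>j. {\<omega> \<in> space M. X \<omega> = k j})" by auto
  have "{\<omega> \<in> space M. X \<omega> \<in> range k} \<in> events" unfolding range_eq by measurable
  have "prob {\<omega> \<in> space M. X \<omega> \<in> range k} = (\<Sum>j\<in>UNIV. prob {\<omega> \<in> space M. X \<omega> = k j})"
    unfolding range_eq using \<open>inj k\<close> by (intro finite_measure_finite_Union) (auto simp: disjoint_family_on_def dest: injD)
  then have "prob {\<omega> \<in> space M. X \<omega> \<in> range k} = 1" using assms(3) by simp
  then show ?thesis using \<open>_ \<in> events\<close> by (subst (asm) prob_Collect_eq_1)
qed

lemma (in prob_space) expectation_arrivals:
  fixes ord :: "nat \<Rightarrow> 'a \<Rightarrow> real \<times> (real^'m::finite)"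
  assumes ord: "\<And>s. s \<in> {1..T} \<Longrightarrow> ord s \<in> borel_measurable M"
    and p: "\<And>s. s \<in> {1..T} \<Longrightarrow> prob {\<omega> \<in> space M. ord s \<omega> = k} = p"
  shows "integrable M (\<lambda>\<omega>. real (arrivals k (\<lambda>s. ord s \<omega>) T))"
    and "expectation (\<lambda>\<omega>. real (arrivals k (\<lambda>s. ord s \<omega>) T)) = real T * p"
proof -
  have *: "has_bochner_integral M (\<lambda>\<omega>. of_bool (ord s \<omega> = k)) p" if s: "s \<in> {1..T}" for s
  proof -
    note [measurable] = ord[OF s]
    have "has_bochner_integral M (indicator {\<omega> \<in> space M. ord s \<omega> = k}) (prob {\<omega> \<in> space M. ord s \<omega> = k})"
      by (intro has_bochner_integral_real_indicator) (auto simp: less_top[symmetric])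
    then show ?thesis
      unfolding p[OF s] by (rule has_bochner_integral_cong[THEN iffD1, rotated 3]) (auto simp: indicator_def)
  qed
  have "has_bochner_integral M (\<lambda>\<omega>. \<Sum>s = 1..T. of_bool (ord s \<omega> = k)) (\<Sum>s = 1..T. p)"
    by (rule has_bochner_integral_sum) (rule *)
  then have "has_bochner_integral M (\<lambda>\<omega>. real (arrivals k (\<lambda>s. ord s \<omega>) T)) (real T * p)"
    unfolding arrivals_eq_sum by simp
  then show "integrable M (\<lambda>\<omega>. real (arrivals k (\<lambda>s. ord s \<omega>) T))"
    and "expectation (\<lambda>\<omega>. real (arrivals k (\<lambda>s. ord s \<omega>) T)) = real T * p"
    by (auto simp: has_bochner_integral_iff)
qed

section \<open>Expected regret from the dual value and the balance along paths\<close>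

theorem proposition1:
  fixes M :: "'w measure" and S :: "'u measure"
    and T :: nat and p \<mu> :: "'n::finite \<Rightarrow> real" and c :: "'n \<Rightarrow> real^'m::finite"
    and b B lam :: "real^'m" and \<gamma> :: "real^'n"
    and ord :: "nat \<Rightarrow> 'w \<Rightarrow> real \<times> (real^'m)" and U :: "'w \<Rightarrow> 'u"
    and \<pi> :: "nat \<Rightarrow> 'u \<times> (nat \<Rightarrow> real \<times> (real^'m)) \<Rightarrow> real"
    and x :: "'w \<Rightarrow> nat \<Rightarrow> real" and q :: "'w \<Rightarrow> nat \<Rightarrow> real \<times> (real^'m)" and \<tau> :: "'w \<Rightarrow> nat"
  assumes prob: "prob_space M"
    and mu_range: "\<And>j. 0 \<le> \<mu> j \<and> \<mu> j \<le> 1"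
    and c_nonneg: "\<And>j i. 0 \<le> c j $ i"
    and c_norm: "\<And>j. infnorm (c j) \<le> 1"
    and types_distinct: "inj (\<lambda>j. (\<mu> j, c j))"
    and p_pos: "\<And>j. 0 < p j"
    and p_sum: "(\<Sum>j\<in>UNIV. p j) = 1"
    and b_pos: "\<And>i. 0 < b $ i"
    and B_eq: "B = real T *\<^sub>R b"
    and iid: "iid_orders M T p \<mu> c ord"
    and nondeg: "nondegenerate p \<mu> c b"
    and dual: "dual_optimal p \<mu> c b lam \<gamma>"
    and policy: "online_policy M T B ord S U \<pi>"
    and q_eq: "q = (\<lambda>\<omega> t. ord t \<omega>)"
    and x_eq: "x = decision \<pi> U ord"
    and tau_eq: "\<tau> = (\<lambda>\<omega>. stop_time T B (q \<omega>) (x \<omega>))"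
  shows "regret M T p \<mu> c b ord U \<pi> =
      (\<Sum>j\<in>{j. \<mu> j \<ge> c j \<bullet> lam}. (\<mu> j - c j \<bullet> lam) *
         (\<integral>\<omega>. real (arrivals (\<mu> j, c j) (q \<omega>) T)
               - real (accepted (\<mu> j, c j) (q \<omega>) (x \<omega>) (\<tau> \<omega>)) \<partial>M))
    + (\<Sum>j\<in>{j. \<mu> j < c j \<bullet> lam}. (c j \<bullet> lam - \<mu> j) *
         (\<integral>\<omega>. real (accepted (\<mu> j, c j) (q \<omega>) (x \<omega>) (\<tau> \<omega>)) \<partial>M))
    + lam \<bullet> (\<integral>\<omega>. remaining B (q \<omega>) (x \<omega>) (\<tau> \<omega> + 1) \<partial>M)"
proof -
  interpret prob_space M by (rule prob)
  define k where "k j = (\<mu> j, c j)" for j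
  define A where "A j \<omega> = real (accepted (k j) (q \<omega>) (x \<omega>) (\<tau> \<omega>))" for j \<omega>
  \<comment> \<open>The profit of a type net of the dual price of its resources; its sign separates
    the two index sets.\<close>
  define e where "e j = \<mu> j - c j \<bullet> lam" for j
  have ord: "ord s \<in> borel_measurable M" if "s \<in> {1..T}" for s
    using iid that by (auto simp: iid_orders_def indep_vars_def)
  have ord_p: "prob {\<omega> \<in> space M. ord s \<omega> = k j} = p j" if "s \<in> {1..T}" for s j
    using iid that by (auto simp: iid_orders_def k_def)
  have xm: "(\<lambda>\<omega>. x \<omega> s) \<in> measurable M (count_space {0, 1})" if "s \<in> {1..T}" for s
    unfolding x_eq by (rule online_policy_decision_measurable[OF policy ord that])
  have x_borel: "(\<lambda>\<omega>. x \<omega> s) \<in> borel_measurable M" if "s \<in> {1..T}" for s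
    using measurable_compose[OF xm[OF that], of "\<lambda>r. r" borel] by simp
  have \<tau>_le: "\<tau> \<omega> \<le> T" for \<omega> by (simp add: tau_eq stop_time_le)
  have \<tau>_meas: "\<tau> \<in> measurable M (count_space UNIV)"
    unfolding tau_eq q_eq by (intro measurable_stop_time ord x_borel)
  have inj_k: "inj k" using types_distinct by (simp add: k_def[abs_def])
  have "AE \<omega> in M. \<forall>s\<in>{1..T}. ord s \<omega> \<in> range k"
    using p_sum ord_p by (intro AE_finite_allI AE_in_range ord inj_k) auto
  \<comment> \<open>Both identities extend only up to \<tau>, which is at most \<open>T\<close>, so
    the almost sure range of the orders in periods 1 to \<open>T\<close> suffices.\<close>
  then have by_type: "AE \<omega> in M.
      (\<Sum>t = 1..\<tau> \<omega>. x \<omega> t * fst (ord t \<omega>)) = (\<Sum>j\<in>UNIV. A j \<omega> * \<mu> j) \<and>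
      (\<Sum>t = 1..\<tau> \<omega>. x \<omega> t *\<^sub>R snd (ord t \<omega>)) = (\<Sum>j\<in>UNIV. A j \<omega> *\<^sub>R c j)"
  proof (rule AE_mp, intro AE_I2 impI)
    fix \<omega> assume \<omega>: "\<omega> \<in> space M" and "\<forall>s\<in>{1..T}. ord s \<omega> \<in> range k"
    then have 1: "\<And>s. s \<in> {1..\<tau> \<omega>} \<Longrightarrow> q \<omega> s \<in> range k"
      using \<tau>_le[of \<omega>] by (auto simp: q_eq)
    have 2: "\<And>s. s \<in> {1..\<tau> \<omega>} \<Longrightarrow> x \<omega> s \<in> {0, 1}"
      using \<tau>_le[of \<omega>] measurable_space[OF xm \<omega>] by fastforce
    show "(\<Sum>t = 1..\<tau> \<omega>. x \<omega> t * fst (ord t \<omega>)) = (\<Sum>j\<in>UNIV. A j \<omega> * \<mu> j) \<and>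
      (\<Sum>t = 1..\<tau> \<omega>. x \<omega> t *\<^sub>R snd (ord t \<omega>)) = (\<Sum>j\<in>UNIV. A j \<omega> *\<^sub>R c j)"
      using sum_by_type[OF inj_k 1 2, where f = fst] sum_by_type[OF inj_k 1 2, where f = snd]
      by (simp add: q_eq A_def k_def)
  qed
  have A_meas: "A j \<in> borel_measurable M" for j
    unfolding A_def accepted_eq_sum
  proof (rule borel_measurable_sum_random_upto[OF \<tau>_meas \<tau>_le])
    fix s assume s: "s \<in> {1..T}"
    note [measurable] = ord[OF s] x_borel[OF s]
    show "(\<lambda>\<omega>. of_bool (q \<omega> s = k j \<and> x \<omega> s = 1) :: real) \<in> borel_measurable M"
      unfolding of_bool_def q_eq by measurable
  qed
  have A_int: "integrable M (A j)" for j
  proof (rule integrable_const_bound[where B = "real T"])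
    show "AE \<omega> in M. norm (A j \<omega>) \<le> real T"
      by (simp add: A_def order_trans[OF accepted_le \<tau>_le])
  qed (rule A_meas)
  \<comment> \<open>\<open>integral_cong_AE\<close> asks for measurability of both integrands, hence
    also of the path sums that are about to be replaced by counts.\<close>
  have rx_meas: "(\<lambda>\<omega>. \<Sum>t = 1..\<tau> \<omega>. x \<omega> t * fst (ord t \<omega>)) \<in> borel_measurable M"
  proof (rule borel_measurable_sum_random_upto[OF \<tau>_meas \<tau>_le])
    fix s assume s: "s \<in> {1..T}"
    note [measurable] = ord[OF s] x_borel[OF s]
    show "(\<lambda>\<omega>. x \<omega> s * fst (ord s \<omega>)) \<in> borel_measurable M"
      by measurable
  qed
  have xa_meas: "(\<lambda>\<omega>. \<Sum>t = 1..\<tau> \<omega>. x \<omega> t *\<^sub>R snd (ord t \<omega>)) \<in> borel_measurable M"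
  proof (rule borel_measurable_sum_random_upto[OF \<tau>_meas \<tau>_le])
    fix s assume s: "s \<in> {1..T}"
    note [measurable] = ord[OF s] x_borel[OF s]
    show "(\<lambda>\<omega>. x \<omega> s *\<^sub>R snd (ord s \<omega>)) \<in> borel_measurable M"
      by measurable
  qed
  have EA: "(\<integral>\<omega>. (\<Sum>j\<in>UNIV. A j \<omega> * \<mu> j) \<partial>M) = (\<Sum>j\<in>UNIV. expectation (A j) * \<mu> j)"
    "(\<integral>\<omega>. (\<Sum>j\<in>UNIV. A j \<omega> *\<^sub>R c j) \<partial>M) = (\<Sum>j\<in>UNIV. expectation (A j) *\<^sub>R c j)"
    using A_int by simp_all
  have "regret M T p \<mu> c b ord U \<pi> =
      (\<integral>\<omega>. real T * OPT_D p \<mu> c b - (\<Sum>t = 1..\<tau> \<omega>. x \<omega> t * fst (ord t \<omega>)) \<partial>M)"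
    by (simp add: regret_def tau_eq x_eq q_eq B_eq mult.commute)
  also have "\<dots> = (\<integral>\<omega>. real T * OPT_D p \<mu> c b - (\<Sum>j\<in>UNIV. A j \<omega> * \<mu> j) \<partial>M)"
    using by_type A_meas rx_meas by (intro integral_cong_AE) auto
  also have "\<dots> = real T * OPT_D p \<mu> c b - (\<Sum>j\<in>UNIV. expectation (A j) * \<mu> j)"
    using A_int by (subst Bochner_Integration.integral_diff) (auto simp: EA prob_space)
  finally have regret: "regret M T p \<mu> c b ord U \<pi> =
      real T * OPT_D p \<mu> c b - (\<Sum>j\<in>UNIV. expectation (A j) * \<mu> j)" .
  have "(\<integral>\<omega>. remaining B (q \<omega>) (x \<omega>) (\<tau> \<omega> + 1) \<partial>M) = (\<integral>\<omega>. B - (\<Sum>j\<in>UNIV. A j \<omega> *\<^sub>R c j) \<partial>M)"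
    using by_type A_meas xa_meas by (intro integral_cong_AE) (auto simp: remaining_Suc q_eq)
  also have "\<dots> = B - (\<Sum>j\<in>UNIV. expectation (A j) *\<^sub>R c j)"
    using A_int by (subst Bochner_Integration.integral_diff) (auto simp: EA prob_space)
  finally have left: "lam \<bullet> (\<integral>\<omega>. remaining B (q \<omega>) (x \<omega>) (\<tau> \<omega> + 1) \<partial>M)
      = real T * (b \<bullet> lam) - (\<Sum>j\<in>UNIV. expectation (A j) * (c j \<bullet> lam))"
    by (simp add: B_eq inner_diff_right inner_sum_right inner_commute)
  have arr: "(\<integral>\<omega>. real (arrivals (\<mu> j, c j) (q \<omega>) T)
               - real (accepted (\<mu> j, c j) (q \<omega>) (x \<omega>) (\<tau> \<omega>)) \<partial>M) = real T * p j - expectation (A j)" for j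
    using expectation_arrivals[of T ord, OF ord ord_p] A_int
    unfolding k_def[symmetric] A_def[symmetric] by (simp add: q_eq)
  have split: "sum f UNIV = sum f {j. \<mu> j \<ge> c j \<bullet> lam} + sum f {j. \<mu> j < c j \<bullet> lam}" for f :: "'n \<Rightarrow> real"
  proof -
    have "UNIV = {j. \<mu> j \<ge> c j \<bullet> lam} \<union> {j. \<mu> j < c j \<bullet> lam}" by auto
    then show ?thesis by (metis (no_types, lifting) sum.union_disjoint finite disjoint_iff mem_Collect_eq not_le)
  qed
  \<comment> \<open>As \<open>p j > 0\<close>, the sign of \<open>p j * e j\<close> is that of
    \<open>e j\<close>, so the positive part vanishes off the first index set.\<close>
  have pos_part: "(\<Sum>j\<in>UNIV. max 0 (p j * e j)) = (\<Sum>j\<in>{j. \<mu> j \<ge> c j \<bullet> lam}. p j * e j)"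
  proof (rule sum.mono_neutral_cong_right)
    show "\<forall>j\<in>UNIV - {j. \<mu> j \<ge> c j \<bullet> lam}. max 0 (p j * e j) = 0"
      using p_pos by (auto simp: e_def less_imp_le intro!: max_absorb1 mult_nonneg_nonpos)
    show "max 0 (p j * e j) = p j * e j" if "j \<in> {j. \<mu> j \<ge> c j \<bullet> lam}" for j
      using that p_pos[of j] by (simp add: e_def)
  qed auto
  have "regret M T p \<mu> c b ord U \<pi> = real T * (b \<bullet> lam) + real T * (\<Sum>j\<in>{j. \<mu> j \<ge> c j \<bullet> lam}. p j * e j)
      - (\<Sum>j\<in>UNIV. expectation (A j) * \<mu> j)"
    unfolding regret OPT_D_eq_dual_value[OF b_pos dual] pos_part[unfolded e_def]
    by (simp add: e_def distrib_left)
  \<comment> \<open>Writing \<open>\<mu> j = e j + c j \<bullet> lam\<close> in the collected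
    reward, the price part joins \<open>b \<bullet> lam\<close> to form the value of leftover
    capacity. The \<open>e j\<close> part is split by sign and, on the first set, merges with the
    expected arrivals \<open>real T * p j\<close>.\<close>
  also have "\<dots> = (\<Sum>j\<in>{j. \<mu> j \<ge> c j \<bullet> lam}. e j * (real T * p j - expectation (A j)))
      + (\<Sum>j\<in>{j. \<mu> j < c j \<bullet> lam}. - e j * expectation (A j))
      + (real T * (b \<bullet> lam) - (\<Sum>j\<in>UNIV. expectation (A j) * (c j \<bullet> lam)))"
    unfolding split
    by (simp add: e_def algebra_simps sum.distrib sum_subtractf sum_distrib_left)
  finally show ?thesis
    unfolding left arr by (simp add: e_def A_def[abs_def] k_def)
qed

end
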